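(* Let $R$ be an integral domain that is not a field. Let $x\in R$. Then $\mathrm{cl}_{\widetilde{M(R)}}(\{x\})=\langle x\rangle$ if and only if $\langle x\rangle$ is closed in $\widetilde{M(R)}$. Similarly, if $x\in R^0$, then $\mathrm{cl}_{M(R)}(\{x\})=\langle x\rangle^0$ if and only if $\langle x\rangle^0$ is closed in $M(R)$.
   Context: For $X\subset R$, $X^0=X\setminus\{0\}$; $\langle r\rangle$ is the ideal of $R$ generated by $r$. For $r\in R$ let $\sigma_r=\{s\in R:\langle r\rangle+\langle s\rangle=R\}$. $\widetilde{M(R)}$ is the set $R$ with the topology having the basis $\{\sigma_r: r\in R\}$. The Macías space $M(R)$ is the set $R^0$ with the topology having the basis $\{\sigma_k^0: k\in R^0\}$. $\mathrm{cl}_Y(A)$ denotes the closure of $A$ in the topological space $Y$. *)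

theory Defs
  imports "HOL-Algebra.Ideal" "HOL-Analysis.Abstract_Topology"
begin

definition macias_sigma :: "('a, 'm) ring_scheme \<Rightarrow> 'a \<Rightarrow> 'a set"
  where "macias_sigma R r =
    {s \<in> carrier R. Idl\<^bsub>R\<^esub> {r} <+>\<^bsub>R\<^esub> Idl\<^bsub>R\<^esub> {s} = carrier R}"

definition nz :: "('a, 'm) ring_scheme \<Rightarrow> 'a set \<Rightarrow> 'a set"
  where "nz R X = X - {\<zero>\<^bsub>R\<^esub>}"

text \<open>
  \<^const>\<open>topology_generated_by\<close> makes a family a subbasis in general. The two families
  used here are bases; see the lemmas \<open>openin_macias_tilde\<close> and \<open>openin_macias\<close> below.
\<close>

definition macias_tilde :: "('a, 'm) ring_scheme \<Rightarrow> 'a topology"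
  where "macias_tilde R = topology_generated_by {macias_sigma R r | r. r \<in> carrier R}"

definition macias :: "('a, 'm) ring_scheme \<Rightarrow> 'a topology"
  where "macias R =
    topology_generated_by {nz R (macias_sigma R k) | k. k \<in> nz R (carrier R)}"

lemma (in cring) macias_sigma_iff:
  assumes r: "r \<in> carrier R"
  shows "s \<in> macias_sigma R r \<longleftrightarrow>
    s \<in> carrier R \<and> (\<exists>a\<in>carrier R. \<exists>b\<in>carrier R. a \<otimes> r \<oplus> b \<otimes> s = \<one>)"
proof (cases "s \<in> carrier R")
  case s: True
  have I: "ideal (Idl {r} <+> Idl {s}) R"
    using r s by (intro add_ideals genideal_ideal) auto
  have "Idl {r} <+> Idl {s} = carrier R \<longleftrightarrow> \<one> \<in> Idl {r} <+> Idl {s}"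
    using ideal.one_imp_carrier[OF I] by auto
  also have "\<dots> \<longleftrightarrow> (\<exists>a\<in>carrier R. \<exists>b\<in>carrier R. a \<otimes> r \<oplus> b \<otimes> s = \<one>)"
    unfolding cgenideal_eq_genideal[OF r, symmetric] cgenideal_eq_genideal[OF s, symmetric]
      set_add_def' cgenideal_def
    by (auto; metis)
  finally show ?thesis using s by (simp add: macias_sigma_def)
qed (simp add: macias_sigma_def)

lemma (in cring) macias_sigma_one: "macias_sigma R \<one> = carrier R"
proof -
  have "s \<in> macias_sigma R \<one>" if s: "s \<in> carrier R" for s
  proof -
    have "\<one> \<otimes> \<one> \<oplus> \<zero> \<otimes> s = \<one>" using s by simp
    then show ?thesis using s by (subst macias_sigma_iff) blast+
  qed
  then show ?thesis by (auto simp: macias_sigma_def)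
qed

lemma (in cring) macias_sigma_Int:
  assumes r: "r \<in> carrier R" and s: "s \<in> carrier R"
  shows "macias_sigma R r \<inter> macias_sigma R s = macias_sigma R (r \<otimes> s)"
proof (intro equalityI subsetI)
  fix t assume "t \<in> macias_sigma R r \<inter> macias_sigma R s"
  then obtain a b c d where t: "t \<in> carrier R"
    and abcd: "a \<in> carrier R" "b \<in> carrier R" "c \<in> carrier R" "d \<in> carrier R"
    and e: "a \<otimes> r \<oplus> b \<otimes> t = \<one>" "c \<otimes> s \<oplus> d \<otimes> t = \<one>"
    using r s by (auto simp: macias_sigma_iff)
  have "(a \<otimes> c) \<otimes> (r \<otimes> s) \<oplus> (a \<otimes> r \<otimes> d \<oplus> b \<otimes> (c \<otimes> s \<oplus> d \<otimes> t)) \<otimes> t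
      = (a \<otimes> r \<oplus> b \<otimes> t) \<otimes> (c \<otimes> s \<oplus> d \<otimes> t)"
    using r s t abcd by algebra
  also have "\<dots> = \<one>" using e by simp
  finally have "(a \<otimes> c) \<otimes> (r \<otimes> s) \<oplus> (a \<otimes> r \<otimes> d \<oplus> b \<otimes> (c \<otimes> s \<oplus> d \<otimes> t)) \<otimes> t = \<one>" .
  moreover have "a \<otimes> c \<in> carrier R" "a \<otimes> r \<otimes> d \<oplus> b \<otimes> (c \<otimes> s \<oplus> d \<otimes> t) \<in> carrier R"
    using r s t abcd by simp_all
  ultimately show "t \<in> macias_sigma R (r \<otimes> s)"
    unfolding macias_sigma_iff[OF m_closed[OF r s]] using t by blast
next
  fix t assume "t \<in> macias_sigma R (r \<otimes> s)"
  then obtain a b where t: "t \<in> carrier R"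
    and ab: "a \<in> carrier R" "b \<in> carrier R" and e: "a \<otimes> (r \<otimes> s) \<oplus> b \<otimes> t = \<one>"
    using r s by (auto simp: macias_sigma_iff)
  have "(a \<otimes> s) \<otimes> r \<oplus> b \<otimes> t = \<one>" "(a \<otimes> r) \<otimes> s \<oplus> b \<otimes> t = \<one>"
    using r s t ab e by (simp_all add: m_ac)
  moreover have "a \<otimes> s \<in> carrier R" "a \<otimes> r \<in> carrier R" using r s ab by simp_all
  ultimately show "t \<in> macias_sigma R r \<inter> macias_sigma R s"
    unfolding Int_iff macias_sigma_iff[OF r] macias_sigma_iff[OF s] using t ab by blast
qed

lemma openin_topology_generated_by_base:
  assumes "\<And>A B. A \<in> \<B> \<Longrightarrow> B \<in> \<B> \<Longrightarrow> A \<inter> B \<in> \<B>"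
  shows "openin (topology_generated_by \<B>) U \<longleftrightarrow> (\<exists>\<C>\<subseteq>\<B>. U = \<Union>\<C>)"
proof
  have ist: "istopology (arbitrary union_of (\<lambda>A. A \<in> \<B>))"
    using assms by (intro istopology_base) auto
  assume "openin (topology_generated_by \<B>) U"
  then have "generate_topology_on \<B> U" by (rule openin_topology_generated_by)
  then have "(arbitrary union_of (\<lambda>A. A \<in> \<B>)) U"
    by (rule generate_topology_on_coarsest[OF ist, rotated])
       (auto intro: union_of_inc simp: arbitrary_def)
  then show "\<exists>\<C>\<subseteq>\<B>. U = \<Union>\<C>"
    by (auto simp: union_of_def arbitrary_def)
next
  assume "\<exists>\<C>\<subseteq>\<B>. U = \<Union>\<C>"
  then show "openin (topology_generated_by \<B>) U"
    by (metis openin_Union subsetD topology_generated_by_Basis)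
qed

lemma (in domain) openin_macias_tilde:
  "openin (macias_tilde R) U \<longleftrightarrow>
    (\<exists>\<C>\<subseteq>{macias_sigma R r | r. r \<in> carrier R}. U = \<Union>\<C>)"
  unfolding macias_tilde_def
proof (rule openin_topology_generated_by_base)
  fix A B assume "A \<in> {macias_sigma R r | r. r \<in> carrier R}"
    "B \<in> {macias_sigma R r | r. r \<in> carrier R}"
  then show "A \<inter> B \<in> {macias_sigma R r | r. r \<in> carrier R}"
    using macias_sigma_Int by fastforce
qed

lemma (in domain) openin_macias:
  "openin (macias R) U \<longleftrightarrow>
    (\<exists>\<C>\<subseteq>{nz R (macias_sigma R k) | k. k \<in> nz R (carrier R)}. U = \<Union>\<C>)"
  unfolding macias_def
proof (rule openin_topology_generated_by_base)
  fix A B assume "A \<in> {nz R (macias_sigma R k) | k. k \<in> nz R (carrier R)}"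
    "B \<in> {nz R (macias_sigma R k) | k. k \<in> nz R (carrier R)}"
  then obtain k l where kl: "k \<in> nz R (carrier R)" "l \<in> nz R (carrier R)"
    and AB: "A = nz R (macias_sigma R k)" "B = nz R (macias_sigma R l)" by auto
  have "k \<otimes> l \<in> nz R (carrier R)" using kl by (auto simp: nz_def integral_iff)
  moreover have "A \<inter> B = nz R (macias_sigma R (k \<otimes> l))"
    using kl macias_sigma_Int[of k l] by (auto simp: AB nz_def)
  ultimately show "A \<inter> B \<in> {nz R (macias_sigma R k) | k. k \<in> nz R (carrier R)}"
    by blast
qed

lemma (in domain) topspace_macias_tilde: "topspace (macias_tilde R) = carrier R"
  unfolding macias_tilde_def topology_generated_by_topspace
  using macias_sigma_one by (auto simp: macias_sigma_def)

lemma (in domain) topspace_macias: "topspace (macias R) = nz R (carrier R)"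
proof -
  have "nz R (carrier R) \<in> {nz R (macias_sigma R k) | k. k \<in> nz R (carrier R)}"
    using macias_sigma_one by (force simp: nz_def)
  then show ?thesis
    unfolding macias_def topology_generated_by_topspace
    by (auto simp: nz_def macias_sigma_def)
qed

end

theory Submission
  imports Defs
begin

text \<open>
  Every multiple of \<open>x\<close> lies in the ideal generated by \<open>x\<close>, so an element comaximal with
  \<open>c \<otimes> x\<close> is already comaximal with \<open>x\<close>. Every basic open set, and hence every open set,
  that contains a multiple of \<open>x\<close> therefore contains \<open>x\<close> itself (\<open>openin_macias_tilde_factor\<close>,
  \<open>openin_macias_factor\<close>). In other words, the principal ideal of \<open>x\<close>, without \<open>\<zero>\<close>
  in the case of the second space, lies in the closure of the point \<open>x\<close>. Since this set
  also contains \<open>x\<close>, it equals the closure exactly when it is closed: the closure is the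
  smallest closed set containing \<open>x\<close> (\<open>closure_of_singleton_eq_iff\<close>).
\<close>

lemma closure_of_singleton_eq_iff:
  assumes "x \<in> S" and "S \<subseteq> X closure_of {x}"
  shows "X closure_of {x} = S \<longleftrightarrow> closedin X S"
proof
  assume "X closure_of {x} = S"
  then show "closedin X S" by (metis closedin_closure_of)
next
  assume "closedin X S"
  then have "X closure_of {x} \<subseteq> S" using assms(1) by (intro closure_of_minimal) auto
  then show "X closure_of {x} = S" using assms(2) by blast
qed

context cring
begin

text \<open>
  A Bezout identity \<open>a \<otimes> r \<oplus> b \<otimes> (c \<otimes> x) = \<one>\<close> is, after
  reassociating, a Bezout identity for \<open>r\<close> and \<open>x\<close>.
\<close>

lemma macias_sigma_factor:
  assumes r: "r \<in> carrier R" and c: "c \<in> carrier R" and x: "x \<in> carrier R"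
    and "c \<otimes> x \<in> macias_sigma R r"
  shows "x \<in> macias_sigma R r"
proof -
  from assms(4) obtain a b where ab: "a \<in> carrier R" "b \<in> carrier R"
    and "a \<otimes> r \<oplus> b \<otimes> (c \<otimes> x) = \<one>"
    unfolding macias_sigma_iff[OF r] by blast
  then have "a \<otimes> r \<oplus> (b \<otimes> c) \<otimes> x = \<one>" using c x by (simp add: m_assoc)
  then show ?thesis unfolding macias_sigma_iff[OF r] using ab c x by blast
qed

end

context domain
begin

lemma openin_macias_tilde_factor:
  assumes "openin (macias_tilde R) U" and "c \<in> carrier R" "x \<in> carrier R" "c \<otimes> x \<in> U"
  shows "x \<in> U"
proof -
  obtain \<C> where "\<C> \<subseteq> {macias_sigma R r | r. r \<in> carrier R}" and U: "U = \<Union>\<C>"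
    using assms(1) unfolding openin_macias_tilde by blast
  then obtain r where "r \<in> carrier R" "macias_sigma R r \<in> \<C>" "c \<otimes> x \<in> macias_sigma R r"
    using assms(4) by blast
  then show ?thesis using macias_sigma_factor assms(2,3) U by blast
qed

lemma openin_macias_factor:
  assumes "openin (macias R) U" and "c \<in> carrier R" "x \<in> nz R (carrier R)" "c \<otimes> x \<in> U"
  shows "x \<in> U"
proof -
  obtain \<C> where "\<C> \<subseteq> {nz R (macias_sigma R k) | k. k \<in> nz R (carrier R)}" and U: "U = \<Union>\<C>"
    using assms(1) unfolding openin_macias by blast
  then obtain k where k: "k \<in> carrier R" "nz R (macias_sigma R k) \<in> \<C>"
      "c \<otimes> x \<in> nz R (macias_sigma R k)"
    using assms(4) unfolding nz_def by blast
  then have "x \<in> nz R (macias_sigma R k)"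
    using macias_sigma_factor assms(2,3) unfolding nz_def by blast
  then show ?thesis using k(2) U by blast
qed

lemma genideal_subset_closure_of_macias_tilde:
  assumes x: "x \<in> carrier R"
  shows "Idl {x} \<subseteq> macias_tilde R closure_of {x}"
proof
  fix y assume "y \<in> Idl {x}"
  then obtain c where "c \<in> carrier R" "y = c \<otimes> x"
    unfolding cgenideal_eq_genideal[OF x, symmetric] cgenideal_def by blast
  then show "y \<in> macias_tilde R closure_of {x}"
    using openin_macias_tilde_factor x by (auto simp: in_closure_of topspace_macias_tilde)
qed

lemma nz_genideal_subset_closure_of_macias:
  assumes x: "x \<in> nz R (carrier R)"
  shows "nz R (Idl {x}) \<subseteq> macias R closure_of {x}"
proof
  fix y assume y: "y \<in> nz R (Idl {x})"
  have xR: "x \<in> carrier R" using x by (simp add: nz_def)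
  from y obtain c where "c \<in> carrier R" "y = c \<otimes> x" "y \<noteq> \<zero>"
    unfolding cgenideal_eq_genideal[OF xR, symmetric] cgenideal_def nz_def by blast
  moreover from this have "y \<in> topspace (macias R)"
    using xR by (simp add: topspace_macias nz_def)
  ultimately show "y \<in> macias R closure_of {x}"
    using openin_macias_factor x by (auto simp: in_closure_of)
qed

end

theorem theorem3p2:
  fixes R :: "('a, 'm) ring_scheme"
  assumes "domain R" and "\<not> field R"
  shows "(\<forall>x \<in> carrier R.
            macias_tilde R closure_of {x} = Idl\<^bsub>R\<^esub> {x} \<longleftrightarrow>
            closedin (macias_tilde R) (Idl\<^bsub>R\<^esub> {x})) \<and>
         (\<forall>x \<in> nz R (carrier R).
            macias R closure_of {x} = nz R (Idl\<^bsub>R\<^esub> {x}) \<longleftrightarrow>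
            closedin (macias R) (nz R (Idl\<^bsub>R\<^esub> {x})))"
proof -
  interpret domain R by fact
  have self: "x \<in> Idl\<^bsub>R\<^esub> {x}" if "x \<in> carrier R" for x
    using that genideal_self' by blast
  show ?thesis
  proof (intro conjI ballI)
    fix x assume "x \<in> carrier R"
    then show "macias_tilde R closure_of {x} = Idl\<^bsub>R\<^esub> {x} \<longleftrightarrow> closedin (macias_tilde R) (Idl\<^bsub>R\<^esub> {x})"
      by (intro closure_of_singleton_eq_iff self genideal_subset_closure_of_macias_tilde)
  next
    fix x assume x: "x \<in> nz R (carrier R)"
    then have "x \<in> nz R (Idl\<^bsub>R\<^esub> {x})" using self by (simp add: nz_def)
    then show "macias R closure_of {x} = nz R (Idl\<^bsub>R\<^esub> {x}) \<longleftrightarrow> closedin (macias R) (nz R (Idl\<^bsub>R\<^esub> {x}))"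
      using nz_genideal_subset_closure_of_macias[OF x] by (rule closure_of_singleton_eq_iff)
  qed
qed

end
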